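(* Let $q>3$ be a prime power. The ideal $$\mathcal{J}_q+\langle x_{00},\,x_{10}-1,\,x_{01}-1\rangle+\langle x_{0i},\,x_{i0}\colon 2\le i\le q-2\rangle\subset\mathbb{F}_q[\overline{X}_q]$$ is zero-dimensional and radical, and its algebraic set is identified with $\mathcal{RLP}_q$, via the bijection $(s_{ij})_{0\le i,j\le q-2}\mapsto\sum_{i,j=0}^{q-2}s_{ij}x^iy^j$. If $\mathcal{J}_q$ is replaced by $\mathcal{J}_{q,d}$ (for a nonnegative integer $d$), then the algebraic set of the resulting zero-dimensional radical ideal is identified in the same way with $\mathcal{RLP}_{q,d}$.
   Context: $\mathbb{F}_q$ is the finite field with $q$ elements. $\mathcal{LP}_q$ is the set of local permutation polynomials: polynomials $f\in\mathbb{F}_q[x,y]$ of degree less than $q$ in each variable such that, for every $a\in\mathbb{F}_q$, both $f(x,a)$ and $f(a,x)$ act as permutations of $\mathbb{F}_q$. A polynomial $f\in\mathcal{LP}_q$ is reduced if $f(x,0)=x$ and $f(0,y)=y$. $\mathcal{RLP}_q$ is the set of reduced polynomials in $\mathcal{LP}_q$, and $\mathcal{RLP}_{q,d}$ is the subset of those of total degree $d$. $\overline{X}_q:=\{x_{ij}\colon 0\le i,j\le q-2\}$ is a set of variables (all indices below range over $\{0,\ldots,q-2\}$; an empty product is $1$). Put $F(x):=x^{q-1}-1$ and, for $a,b,c\in\mathbb{F}_q$ with $a\ne b$ (with $0^0=1$), $G^{\mathrm{row}}_{a,b,c}:=F(\sum_{i,j=0}^{q-2}(a^i-b^i)c^jx_{ji})$,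 $G^{\mathrm{col}}_{a,b,c}:=F(\sum_{i,j=0}^{q-2}(a^i-b^i)c^jx_{ij})$. Then $$\mathcal{J}_q:=\langle G^{\mathrm{row}}_{a,b,c},\,G^{\mathrm{col}}_{a,b,c}\colon a,b,c\in\mathbb{F}_q,\ a\neq b\rangle+\langle x_{ij}^q-x_{ij}\colon 0\le i,j\le q-2\rangle,$$ $$\mathcal{J}_{q,d}:=\mathcal{J}_q+\langle x_{ij}\colon i+j>d\rangle+\Big\langle\prod_{i+j=d}(x_{ij}^{q-1}-1)\Big\rangle.$$ The algebraic set of an ideal $I$ of a polynomial ring over $\mathbb{F}_q$ in $n$ variables is the set of points of $\mathbb{F}_q^n$ at which all elements of $I$ vanish; $I$ is zero-dimensional if the quotient ring by $I$ is a finite-dimensional $\mathbb{F}_q$-vector space. *)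

theory Defs
  imports
    "HOL-Library.Poly_Mapping"
    "HOL-Number_Theory.Prime_Powers"
    "HOL-Algebra.QuotRing"
    "HOL-Algebra.Embedded_Algebras"
begin

section \<open>Multivariate polynomials\<close>

text \<open>A monomial is an exponent vector of finite support, a polynomial a finitely supported
  map from monomials to coefficients; the ring operations are those of Poly_Mapping.\<close>

type_synonym ('v, 'a) mpoly = "('v \<Rightarrow>\<^sub>0 nat) \<Rightarrow>\<^sub>0 'a"

definition const :: "'a \<Rightarrow> ('v, 'a::comm_ring_1) mpoly" where
  "const c = Poly_Mapping.single 0 c"

definition var :: "'v \<Rightarrow> ('v, 'a::comm_ring_1) mpoly" where
  "var v = Poly_Mapping.single (Poly_Mapping.single v 1) 1"

definition subst :: "('v \<Rightarrow> ('w, 'a) mpoly) \<Rightarrow> ('v, 'a::comm_ring_1) mpoly \<Rightarrow> ('w, 'a) mpoly" where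
  "subst \<sigma> p = (\<Sum>m\<in>Poly_Mapping.keys p. const (Poly_Mapping.lookup p m) *
    (\<Prod>v\<in>Poly_Mapping.keys m. \<sigma> v ^ Poly_Mapping.lookup m v))"

definition eval_at :: "('v \<Rightarrow> 'a) \<Rightarrow> ('v, 'a::comm_ring_1) mpoly \<Rightarrow> 'a" where
  "eval_at s p = (\<Sum>m\<in>Poly_Mapping.keys p. Poly_Mapping.lookup p m *
    (\<Prod>v\<in>Poly_Mapping.keys m. s v ^ Poly_Mapping.lookup m v))"

text \<open>Both degrees of the zero polynomial are \<open>0\<close>.\<close>

definition deg_in :: "'v \<Rightarrow> ('v, 'a::comm_ring_1) mpoly \<Rightarrow> nat" where
  "deg_in v p = Max (insert 0 ((\<lambda>m. Poly_Mapping.lookup m v) ` Poly_Mapping.keys p))"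

definition total_deg :: "('v, 'a::comm_ring_1) mpoly \<Rightarrow> nat" where
  "total_deg p = Max (insert 0 ((\<lambda>m. \<Sum>v\<in>Poly_Mapping.keys m. Poly_Mapping.lookup m v) ` Poly_Mapping.keys p))"

text \<open>The polynomial ring in the variables of \<open>V\<close> only.  The restriction matters: with
  infinitely many variables the quotients below, unless zero, would not be finite-dimensional.\<close>

definition mpoly_ring :: "'v set \<Rightarrow> ('v, 'a::comm_ring_1) mpoly ring" where
  "mpoly_ring V =
    \<lparr>carrier = {p. \<forall>m\<in>Poly_Mapping.keys p. Poly_Mapping.keys m \<subseteq> V}, mult = (*), one = 1, zero = 0, add = (+)\<rparr>"

text \<open>Points are functions that are \<open>undefined\<close> outside \<open>V\<close>, so that they correspond
  one-to-one to the \<open>V\<close>-indexed tuples.\<close>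

definition algebraic_set :: "'v set \<Rightarrow> ('v, 'a::comm_ring_1) mpoly set \<Rightarrow> ('v \<Rightarrow> 'a) set" where
  "algebraic_set V I = {s \<in> V \<rightarrow>\<^sub>E UNIV. \<forall>p\<in>I. eval_at s p = 0}"

text \<open>Scalar multiplication by \<open>c\<close> on the quotient ring is multiplication by the class of the
  constant \<open>c\<close>.  The unit ideal, with quotient of dimension \<open>0\<close>, is allowed.\<close>

definition zero_dimensional :: "'v set \<Rightarrow> ('v, 'a::field) mpoly set \<Rightarrow> bool" where
  "zero_dimensional V I \<longleftrightarrow>
    (let Q = mpoly_ring V Quot I in
      ring.finite_dimension Q (range (\<lambda>c. I +>\<^bsub>mpoly_ring V\<^esub> const c)) (carrier Q))"

definition radical_ideal :: "'b set \<Rightarrow> 'b ring \<Rightarrow> bool" where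
  "radical_ideal I R \<longleftrightarrow> ideal I R \<and>
    (\<forall>p\<in>carrier R. \<forall>n::nat. 0 < n \<longrightarrow> p [^]\<^bsub>R\<^esub> n \<in> I \<longrightarrow> p \<in> I)"


section \<open>Local permutation polynomials\<close>

text \<open>In this and the next section, the field \<open>\<F>\<^sub>q\<close> is the type \<open>'a\<close>, and \<open>q\<close> is meant
  to be its cardinality.\<close>

datatype xy = X | Y

definition LP :: "nat \<Rightarrow> (xy, 'a::{finite,field}) mpoly set" where
  "LP q = {f. deg_in X f < q \<and> deg_in Y f < q \<and>
    (\<forall>a. bij (\<lambda>t. eval_at (case_xy t a) f) \<and> bij (\<lambda>t. eval_at (case_xy a t) f))}"

definition reduced :: "(xy, 'a::{finite,field}) mpoly \<Rightarrow> bool" where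
  "reduced f \<longleftrightarrow> subst (case_xy (var X) 0) f = var X \<and> subst (case_xy 0 (var Y)) f = var Y"

definition RLP :: "nat \<Rightarrow> (xy, 'a::{finite,field}) mpoly set" where
  "RLP q = {f \<in> LP q. reduced f}"

definition RLP_deg :: "nat \<Rightarrow> nat \<Rightarrow> (xy, 'a::{finite,field}) mpoly set" where
  "RLP_deg q d = {f \<in> RLP q. total_deg f = d}"


section \<open>The ideals\<close>

definition idx :: "nat \<Rightarrow> (nat \<times> nat) set" where
  "idx q = {0..q-2} \<times> {0..q-2}"

abbreviation polring :: "nat \<Rightarrow> (nat \<times> nat, 'a::{finite,field}) mpoly ring" where
  "polring q \<equiv> mpoly_ring (idx q)"

definition F :: "nat \<Rightarrow> 'b::comm_ring_1 \<Rightarrow> 'b" where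
  "F q x = x ^ (q - 1) - 1"

definition G_row :: "nat \<Rightarrow> 'a \<Rightarrow> 'a \<Rightarrow> 'a \<Rightarrow> (nat \<times> nat, 'a::{finite,field}) mpoly" where
  "G_row q a b c = F q (\<Sum>(i,j)\<in>idx q. const ((a ^ i - b ^ i) * c ^ j) * var (j, i))"

definition G_col :: "nat \<Rightarrow> 'a \<Rightarrow> 'a \<Rightarrow> 'a \<Rightarrow> (nat \<times> nat, 'a::{finite,field}) mpoly" where
  "G_col q a b c = F q (\<Sum>(i,j)\<in>idx q. const ((a ^ i - b ^ i) * c ^ j) * var (i, j))"

definition J :: "nat \<Rightarrow> (nat \<times> nat, 'a::{finite,field}) mpoly set" where
  "J q = Idl\<^bsub>polring q\<^esub> ({G_row q a b c | a b c. a \<noteq> b} \<union> {G_col q a b c | a b c. a \<noteq> b})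
    <+>\<^bsub>polring q\<^esub> Idl\<^bsub>polring q\<^esub> {var (i, j) ^ q - var (i, j) | i j. (i, j) \<in> idx q}"

definition J_deg :: "nat \<Rightarrow> nat \<Rightarrow> (nat \<times> nat, 'a::{finite,field}) mpoly set" where
  "J_deg q d = J q
    <+>\<^bsub>polring q\<^esub> Idl\<^bsub>polring q\<^esub> {var (i, j) | i j. (i, j) \<in> idx q \<and> i + j > d}
    <+>\<^bsub>polring q\<^esub> Idl\<^bsub>polring q\<^esub> {\<Prod>(i,j)\<in>{(i,j) \<in> idx q. i + j = d}. (var (i, j) ^ (q - 1) - 1)}"

definition add_reduced ::
  "nat \<Rightarrow> (nat \<times> nat, 'a::{finite,field}) mpoly set \<Rightarrow> (nat \<times> nat, 'a) mpoly set" where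
  "add_reduced q I = I
    <+>\<^bsub>polring q\<^esub> Idl\<^bsub>polring q\<^esub> {var (0, 0), var (1, 0) - 1, var (0, 1) - 1}
    <+>\<^bsub>polring q\<^esub> Idl\<^bsub>polring q\<^esub> ({var (0, i) | i. 2 \<le> i \<and> i \<le> q - 2} \<union>
      {var (i, 0) | i. 2 \<le> i \<and> i \<le> q - 2})"

definition poly_of_point :: "nat \<Rightarrow> (nat \<times> nat \<Rightarrow> 'a) \<Rightarrow> (xy, 'a::{finite,field}) mpoly" where
  "poly_of_point q s = (\<Sum>(i,j)\<in>idx q. const (s (i, j)) * var X ^ i * var Y ^ j)"

end

(* Finiteness and radicality only use that the ideal contains the field equations x^q - x: since
   q is a power of the characteristic, p |-> p^q is additive, so p^q - p lies in the ideal for every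
   polynomial p, which makes the ideal radical, and every monomial reduces to one with exponents
   below q, which makes the quotient finite.  At a point s the generators express that the bivariate
   function attached to s is injective in each variable, plus the normalisation and the degree
   condition.  That exponents up to q - 2 suffice is seen by summing a permutation polynomial over
   the field: the sum of all values is 0, and it is also minus the coefficient of x^(q-1). *)
theory Submission
  imports Defs "HOL-Computational_Algebra.Polynomial" "HOL-Number_Theory.Residues" "HOL-Library.Cardinality"
begin

section \<open>Homomorphisms out of polynomial rings\<close>

text \<open>A sum of ideals lies in the kernel of an evaluation exactly when all generators of the
  summands do. So the points of the algebraic sets are found by testing generators, and the ideals
  themselves never have to be described. Inequations become equations because x^(q-1) - 1 vanishes
  exactly at the nonzero x: \<open>G_row\<close> and \<open>G_col\<close> say that two values
  differ, and the product over i + j = d says that some coefficient of degree d is nonzero. Over a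
  finite field, values that differ pairwise already make a permutation. The unit ideal does occur.
  For d = 0 both x_10 and x_10 - 1 lie in the ideal, and for d > 2(q-2) the product is empty, hence
  1. The quotient is then the zero ring, in which the constants do not form a field, so finite
  dimension needs a separate argument there.\<close>

definition mon :: "('v \<Rightarrow> 'b::comm_ring_1) \<Rightarrow> ('v \<Rightarrow>\<^sub>0 nat) \<Rightarrow> 'b" where
  "mon \<sigma> m = (\<Prod>v\<in>Poly_Mapping.keys m. \<sigma> v ^ Poly_Mapping.lookup m v)"

text \<open>A variable coefficient map \<open>h\<close> lets one set of homomorphism laws serve two
  purposes: the identity gives \<open>eval_at\<close>, and \<open>const\<close> gives
  \<open>subst\<close>.\<close>

definition ev :: "('a \<Rightarrow> 'b) \<Rightarrow> ('v \<Rightarrow> 'b) \<Rightarrow> ('v, 'a::comm_ring_1) mpoly \<Rightarrow> 'b::comm_ring_1" where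
  "ev h \<sigma> p = (\<Sum>m\<in>Poly_Mapping.keys p. h (Poly_Mapping.lookup p m) * mon \<sigma> m)"

lemma eval_at_eq_ev: "eval_at s = ev (\<lambda>c. c) s"
  by (simp add: fun_eq_iff eval_at_def ev_def mon_def)

lemma subst_eq_ev: "subst \<sigma> = ev const \<sigma>"
  by (simp add: fun_eq_iff subst_def ev_def mon_def)

lemma mon_superset:
  assumes "finite A" "Poly_Mapping.keys m \<subseteq> A"
  shows "mon \<sigma> m = (\<Prod>v\<in>A. \<sigma> v ^ Poly_Mapping.lookup m v)"
  unfolding mon_def using assms
  by (intro prod.mono_neutral_left) (auto simp: in_keys_iff)

lemma mon_zero [simp]: "mon \<sigma> 0 = 1"
  by (simp add: mon_def)

lemma mon_add: "mon \<sigma> (m + n) = mon \<sigma> m * mon \<sigma> n"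
proof -
  let ?A = "Poly_Mapping.keys m \<union> Poly_Mapping.keys n"
  have "Poly_Mapping.keys (m + n) \<subseteq> ?A"
    by (rule keys_add)
  then show ?thesis
    by (simp add: mon_superset[of ?A] lookup_add power_add prod.distrib)
qed

lemma mon_single: "mon \<sigma> (Poly_Mapping.single v k) = \<sigma> v ^ k"
  by (simp add: mon_superset[of "{v}"])

lemma poly_mapping_eq_sum_single:
  "p = (\<Sum>m\<in>Poly_Mapping.keys p. Poly_Mapping.single m (Poly_Mapping.lookup p m))"
  by (rule poly_mapping_eqI)
    (simp add: lookup_sum lookup_single when_def in_keys_iff)

locale coeff_hom =
  fixes h :: "'a::comm_ring_1 \<Rightarrow> 'b::comm_ring_1"
  assumes h_zero: "h 0 = 0" and h_one: "h 1 = 1"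
    and h_add: "h (a + b) = h a + h b" and h_mult: "h (a * b) = h a * h b"
begin

lemma ev_superset:
  assumes "finite A" "Poly_Mapping.keys p \<subseteq> A"
  shows "ev h \<sigma> p = (\<Sum>m\<in>A. h (Poly_Mapping.lookup p m) * mon \<sigma> m)"
  unfolding ev_def using assms
  by (intro sum.mono_neutral_left) (auto simp: in_keys_iff h_zero)

lemma ev_zero [simp]: "ev h \<sigma> 0 = 0"
  by (simp add: ev_def)

lemma ev_add: "ev h \<sigma> (p + r) = ev h \<sigma> p + ev h \<sigma> r"
proof -
  let ?A = "Poly_Mapping.keys p \<union> Poly_Mapping.keys r"
  have "Poly_Mapping.keys (p + r) \<subseteq> ?A"
    by (rule keys_add)
  then show ?thesis
    by (simp add: ev_superset[of ?A] lookup_add h_add distrib_right sum.distrib)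
qed

lemma ev_uminus: "ev h \<sigma> (- p) = - ev h \<sigma> p"
proof -
  have "ev h \<sigma> (- p) + ev h \<sigma> p = 0"
    by (simp flip: ev_add)
  then show ?thesis
    by (simp add: eq_neg_iff_add_eq_0)
qed

lemma ev_diff: "ev h \<sigma> (p - r) = ev h \<sigma> p - ev h \<sigma> r"
  using ev_add[of \<sigma> p "- r"] by (simp add: ev_uminus)

lemma ev_sum: "ev h \<sigma> (\<Sum>i\<in>A. f i) = (\<Sum>i\<in>A. ev h \<sigma> (f i))"
  by (induction A rule: infinite_finite_induct) (simp_all add: ev_add)

lemma ev_single: "ev h \<sigma> (Poly_Mapping.single m c) = h c * mon \<sigma> m"
  by (simp add: ev_superset[of "{m}"] h_zero)

text \<open>Expanding both factors into single terms reduces multiplicativity to that of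
  \<open>mon\<close>; terms of the product that share a monomial need no collecting.\<close>

lemma ev_mult: "ev h \<sigma> (p * r) = ev h \<sigma> p * ev h \<sigma> r"
proof -
  have "p * r = (\<Sum>m\<in>Poly_Mapping.keys p. \<Sum>n\<in>Poly_Mapping.keys r.
      Poly_Mapping.single (m + n) (Poly_Mapping.lookup p m * Poly_Mapping.lookup r n))"
    by (subst poly_mapping_eq_sum_single[of p], subst poly_mapping_eq_sum_single[of r])
      (simp add: sum_product mult_single)
  then show ?thesis
    by (simp add: ev_sum ev_single h_mult mon_add ev_def[of h \<sigma> p] ev_def[of h \<sigma> r]
        sum_product mult_ac)
qed

lemma ev_const [simp]: "ev h \<sigma> (const c) = h c"
  by (simp add: const_def ev_single)

lemma ev_var [simp]: "ev h \<sigma> (var v) = \<sigma> v"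
  by (simp add: var_def ev_single mon_single h_one)

lemma ev_one [simp]: "ev h \<sigma> 1 = 1"
  using ev_const[of \<sigma> 1] by (simp add: const_def h_one)

lemma ev_power: "ev h \<sigma> (p ^ n) = ev h \<sigma> p ^ n"
  by (induction n) (simp_all add: ev_mult)

lemma ev_prod: "ev h \<sigma> (\<Prod>i\<in>A. f i) = (\<Prod>i\<in>A. ev h \<sigma> (f i))"
  by (induction A rule: infinite_finite_induct) (simp_all add: ev_mult)

lemmas ev_simps = ev_add ev_uminus ev_diff ev_sum ev_mult ev_power ev_prod

end

interpretation eval: coeff_hom "\<lambda>c::'a::comm_ring_1. c"
  by (rule coeff_hom.intro) (rule refl)+

lemma const_zero [simp]: "const 0 = 0"
  by (simp add: const_def)

lemma const_one [simp]: "const 1 = 1"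
  by (simp add: const_def)

lemma const_add: "const (a + b) = const a + const b"
  by (simp add: const_def single_add)

lemma const_mult: "const (a * b) = const a * const b"
  by (simp add: const_def mult_single)

lemma const_uminus: "const (- a) = - const a"
  by (simp add: const_def single_uminus)

lemma const_power: "const (a ^ n) = const a ^ n"
  by (induction n) (simp_all add: const_mult)

interpretation subst: coeff_hom const
  by (rule coeff_hom.intro) (simp_all add: const_add const_mult)

lemma var_power: "var v ^ n = (Poly_Mapping.single (Poly_Mapping.single v n) 1 :: ('v, 'a::comm_ring_1) mpoly)"
  by (induction n) (simp_all add: var_def mult_single flip: single_add)


section \<open>The polynomial ring and its ideals\<close>

lemma carrier_mpoly_ring:
  "p \<in> carrier (mpoly_ring V) \<longleftrightarrow> (\<forall>m\<in>Poly_Mapping.keys p. Poly_Mapping.keys m \<subseteq> V)"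
  by (simp add: mpoly_ring_def)

lemma mpoly_ring_simps [simp]:
  "mult (mpoly_ring V) = (*)" "one (mpoly_ring V) = 1" "zero (mpoly_ring V) = 0"
  "add (mpoly_ring V) = (+)"
  by (simp_all add: mpoly_ring_def)

lemma add_mpoly_carrier [intro]:
  "p \<in> carrier (mpoly_ring V) \<Longrightarrow> r \<in> carrier (mpoly_ring V) \<Longrightarrow> p + r \<in> carrier (mpoly_ring V)"
  using keys_add[of p r] by (fastforce simp: carrier_mpoly_ring)

lemma mult_mpoly_carrier [intro]:
  assumes "p \<in> carrier (mpoly_ring V)" "r \<in> carrier (mpoly_ring V)"
  shows "p * r \<in> carrier (mpoly_ring V)"
  unfolding carrier_mpoly_ring
proof
  fix m assume "m \<in> Poly_Mapping.keys (p * r)"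
  then obtain a b where "m = a + b" "a \<in> Poly_Mapping.keys p" "b \<in> Poly_Mapping.keys r"
    using keys_mult[of p r] by auto
  then show "Poly_Mapping.keys m \<subseteq> V"
    using assms keys_add[of a b] by (fastforce simp: carrier_mpoly_ring)
qed

lemma const_carrier [simp, intro]: "const c \<in> carrier (mpoly_ring V)"
  by (simp add: carrier_mpoly_ring const_def)

lemma zero_carrier [simp, intro]: "0 \<in> carrier (mpoly_ring V)"
  by (simp add: carrier_mpoly_ring)

lemma one_carrier [simp, intro]: "1 \<in> carrier (mpoly_ring V)"
  by (simp add: carrier_mpoly_ring)

lemma var_carrier [intro]: "v \<in> V \<Longrightarrow> var v \<in> carrier (mpoly_ring V)"
  by (simp add: carrier_mpoly_ring var_def)

lemma uminus_carrier [intro]: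
  "p \<in> carrier (mpoly_ring V) \<Longrightarrow> - p \<in> carrier (mpoly_ring V)"
  by (simp add: carrier_mpoly_ring in_keys_iff)

lemma diff_carrier [intro]:
  "p \<in> carrier (mpoly_ring V) \<Longrightarrow> r \<in> carrier (mpoly_ring V) \<Longrightarrow> p - r \<in> carrier (mpoly_ring V)"
  using add_mpoly_carrier[of p V "- r"] by auto

lemma power_carrier [intro]:
  "p \<in> carrier (mpoly_ring V) \<Longrightarrow> p ^ n \<in> carrier (mpoly_ring V)"
  by (induction n) auto

lemma sum_carrier [intro]:
  "(\<And>i. i \<in> A \<Longrightarrow> f i \<in> carrier (mpoly_ring V)) \<Longrightarrow> sum f A \<in> carrier (mpoly_ring V)"
  by (induction A rule: infinite_finite_induct) auto

lemma prod_carrier [intro]: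
  "(\<And>i. i \<in> A \<Longrightarrow> f i \<in> carrier (mpoly_ring V)) \<Longrightarrow> prod f A \<in> carrier (mpoly_ring V)"
  by (induction A rule: infinite_finite_induct) auto

lemma cring_mpoly_ring: "cring (mpoly_ring V)"
proof (rule cringI)
  show "abelian_group (mpoly_ring V)"
  proof (rule abelian_groupI)
    fix p assume "p \<in> carrier (mpoly_ring V)"
    then show "\<exists>r\<in>carrier (mpoly_ring V). r \<oplus>\<^bsub>mpoly_ring V\<^esub> p = \<zero>\<^bsub>mpoly_ring V\<^esub>"
      by (intro bexI[of _ "- p"]) auto
  qed (auto simp: add_ac)
  show "comm_monoid (mpoly_ring V)"
    by (rule comm_monoidI) (auto simp: mult_ac)
qed (simp add: distrib_right)

interpretation MP: cring "mpoly_ring V"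
  by (rule cring_mpoly_ring)

lemma minus_mpoly_ring:
  assumes "p \<in> carrier (mpoly_ring V)" "r \<in> carrier (mpoly_ring V)"
  shows "p \<ominus>\<^bsub>mpoly_ring V\<^esub> r = p - r"
proof -
  have "\<ominus>\<^bsub>mpoly_ring V\<^esub> r = - r"
    using assms by (intro MP.minus_equality) auto
  then show ?thesis
    by (simp add: a_minus_def)
qed

lemma pow_mpoly_ring: "p [^]\<^bsub>mpoly_ring V\<^esub> (n::nat) = p ^ n"
  by (induction n) (simp_all add: mult.commute)

context
  fixes V :: "'v set" and I :: "('v, 'a::comm_ring_1) mpoly set"
  assumes I: "ideal I (mpoly_ring V)"
begin

lemma ideal_mult: "p \<in> carrier (mpoly_ring V) \<Longrightarrow> r \<in> I \<Longrightarrow> p * r \<in> I"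
  using ideal.I_l_closed[OF I] by simp

lemma ideal_add: "p \<in> I \<Longrightarrow> r \<in> I \<Longrightarrow> p + r \<in> I"
  using additive_subgroup.a_closed[OF ideal.axioms(1)[OF I]] by simp

lemma ideal_zero: "0 \<in> I"
  using additive_subgroup.zero_closed[OF ideal.axioms(1)[OF I]] by simp

lemma ideal_uminus: "p \<in> I \<Longrightarrow> - p \<in> I"
  using ideal_mult[of "- 1" p] by auto

lemma ideal_diff: "p \<in> I \<Longrightarrow> r \<in> I \<Longrightarrow> p - r \<in> I"
  using ideal_add[of p "- r"] by (simp add: ideal_uminus)

lemma ideal_sum: "(\<And>i. i \<in> A \<Longrightarrow> f i \<in> I) \<Longrightarrow> sum f A \<in> I"
  by (induction A rule: infinite_finite_induct) (simp_all add: ideal_add ideal_zero)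

lemma ideal_in_carrier: "p \<in> I \<Longrightarrow> p \<in> carrier (mpoly_ring V)"
  using ideal.Icarr[OF I] .

end

text \<open>Constants and the variables from \<open>V\<close> generate the carrier: each term is a
  constant times a product of variable powers. The rule suits properties stable under sums and
  products, such as p^q - p lying in a given ideal.\<close>

lemma mpoly_carrier_induct [consumes 1, case_names const var add mult]:
  assumes "p \<in> carrier (mpoly_ring V)"
    and const: "\<And>c. P (const c)" and var: "\<And>v. v \<in> V \<Longrightarrow> P (var v)"
    and add: "\<And>p r. p \<in> carrier (mpoly_ring V) \<Longrightarrow> r \<in> carrier (mpoly_ring V) \<Longrightarrow> P p \<Longrightarrow> P r \<Longrightarrow> P (p + r)"
    and mult: "\<And>p r. p \<in> carrier (mpoly_ring V) \<Longrightarrow> r \<in> carrier (mpoly_ring V) \<Longrightarrow> P p \<Longrightarrow> P r \<Longrightarrow> P (p * r)"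
  shows "P p"
proof -
  \<comment> \<open>Carrier membership is carried along because \<open>add\<close> and
    \<open>mult\<close> demand it of both operands.\<close>
  let ?Q = "\<lambda>p. p \<in> carrier (mpoly_ring V) \<and> P p"
  have Q1: "?Q 1"
    using const[of 1] by simp
  have Q_pow: "?Q (r ^ n)" if "?Q r" for r n
    using that Q1 by (induction n) (auto intro: mult)
  have Q_prod: "?Q (\<Prod>i\<in>A. f i)" if "\<And>i. i \<in> A \<Longrightarrow> ?Q (f i)" for f :: "'c \<Rightarrow> _" and A
    using that Q1 by (induction A rule: infinite_finite_induct) (auto intro: mult)
  have Q_sum: "?Q (\<Sum>i\<in>A. f i)" if "\<And>i. i \<in> A \<Longrightarrow> ?Q (f i)" for f :: "'d \<Rightarrow> _" and A
    using that const[of 0] by (induction A rule: infinite_finite_induct) (auto intro: add)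
  have single: "Poly_Mapping.single m c = const c * (\<Prod>v\<in>Poly_Mapping.keys m. var v ^ Poly_Mapping.lookup m v)"
    for m :: "'a \<Rightarrow>\<^sub>0 nat" and c :: 'b
  proof -
    have "(\<Prod>v\<in>A. Poly_Mapping.single (g v) 1) = Poly_Mapping.single (\<Sum>v\<in>A. g v) (1::'b)"
      for A :: "'a set" and g :: "'a \<Rightarrow> ('a \<Rightarrow>\<^sub>0 nat)"
      by (induction A rule: infinite_finite_induct) (simp_all add: mult_single)
    then show ?thesis
      by (simp add: var_power const_def mult_single flip: poly_mapping_eq_sum_single)
  qed
  have "?Q (Poly_Mapping.single m c)" if "Poly_Mapping.keys m \<subseteq> V" for m c
  proof -
    have "?Q (\<Prod>v\<in>Poly_Mapping.keys m. var v ^ Poly_Mapping.lookup m v)"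
      by (rule Q_prod, rule Q_pow) (use that var in auto)
    then show ?thesis
      unfolding single using const mult by auto
  qed
  then have "?Q (\<Sum>m\<in>Poly_Mapping.keys p. Poly_Mapping.single m (Poly_Mapping.lookup p m))"
    using assms(1) by (intro Q_sum) (auto simp: carrier_mpoly_ring)
  then show ?thesis
    by (simp flip: poly_mapping_eq_sum_single)
qed

text \<open>This is the kernel of evaluation at \<open>s\<close>. Having it as an ideal turns "every
  element of I vanishes at \<open>s\<close>" into an inclusion of ideals, which generators
  decide.\<close>

lemma ideal_vanishing: "ideal {p \<in> carrier (mpoly_ring V). eval_at s p = 0} (mpoly_ring V)"
proof (rule idealI)
  show "subgroup {p \<in> carrier (mpoly_ring V). eval_at s p = 0} (add_monoid (mpoly_ring V))"
  proof (rule MP.add.subgroupI)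
    fix p assume p: "p \<in> {p \<in> carrier (mpoly_ring V). eval_at s p = 0}"
    then have "\<ominus>\<^bsub>mpoly_ring V\<^esub> p = - p"
      by (intro MP.minus_equality) auto
    with p show "\<ominus>\<^bsub>mpoly_ring V\<^esub> p \<in> {p \<in> carrier (mpoly_ring V). eval_at s p = 0}"
      by (auto simp: eval_at_eq_ev eval.ev_uminus)
  qed (auto simp: eval_at_eq_ev eval.ev_add intro!: exI[of _ 0])
qed (auto simp: MP.ring_axioms eval_at_eq_ev eval.ev_mult)

text \<open>The sum is the least ideal above both summands: pairing an element with 0 from the other
  summand recovers each of them.\<close>

lemma set_add_subset_ideal_iff:
  assumes "ideal I (mpoly_ring V)" "ideal L (mpoly_ring V)" "ideal K (mpoly_ring V)"
  shows "I <+>\<^bsub>mpoly_ring V\<^esub> L \<subseteq> K \<longleftrightarrow> I \<subseteq> K \<and> L \<subseteq> K"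
proof -
  have "I <+>\<^bsub>mpoly_ring V\<^esub> L \<subseteq> K \<longleftrightarrow> (\<forall>a\<in>I. \<forall>b\<in>L. a + b \<in> K)"
    by (auto simp: set_add_def set_mult_def subset_iff)
  also have "\<dots> \<longleftrightarrow> I \<subseteq> K \<and> L \<subseteq> K"
  proof
    assume *: "\<forall>a\<in>I. \<forall>b\<in>L. a + b \<in> K"
    have "a \<in> K" if "a \<in> I" for a
      using bspec[OF bspec[OF * that] ideal_zero[OF assms(2)]] by simp
    moreover have "b \<in> K" if "b \<in> L" for b
      using bspec[OF bspec[OF * ideal_zero[OF assms(1)]] that] by simp
    ultimately show "I \<subseteq> K \<and> L \<subseteq> K"
      by blast
  qed (blast intro: ideal_add[OF assms(3)])
  finally show ?thesis .
qed

lemma Idl_subset_vanishing: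
  assumes "S \<subseteq> carrier (mpoly_ring V)"
  shows "Idl\<^bsub>mpoly_ring V\<^esub> S \<subseteq> {p \<in> carrier (mpoly_ring V). eval_at s p = 0} \<longleftrightarrow>
    (\<forall>p\<in>S. eval_at s p = 0)"
  using assms by (subst MP.Idl_subset_ideal[OF ideal_vanishing]) auto

lemma algebraic_set_ideal:
  assumes "ideal I (mpoly_ring V)"
  shows "algebraic_set V I =
    {s \<in> V \<rightarrow>\<^sub>E UNIV. I \<subseteq> {p \<in> carrier (mpoly_ring V). eval_at s p = 0}}"
  using ideal_in_carrier[OF assms] by (auto simp: algebraic_set_def)

section \<open>Ideals over a finite field containing the field equations\<close>

text \<open>Multiplication by a nonzero x permutes the nonzero elements, so it preserves their
  product while scaling it by x^(q-1). Cancelling the product gives x^(q-1) = 1.\<close>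

lemma finite_field_power_card:
  fixes x :: "'a::{finite,field}"
  shows "x ^ CARD('a) = x"
proof (cases "x = 0")
  case False
  let ?U = "UNIV - {0::'a}"
  have "bij_betw ((*) x) ?U ?U"
    using False by (intro bij_betw_byWitness[where f' = "\<lambda>y. y / x"]) auto
  then have "\<Prod>?U = (\<Prod>y\<in>?U. x * y)"
    using prod.reindex_bij_betw[of "(*) x" ?U ?U "\<lambda>y. y"] by simp
  also have "\<dots> = x ^ card ?U * \<Prod>?U"
    by (simp add: prod.distrib)
  finally have "x ^ card ?U = 1"
    by simp
  moreover have "CARD('a) = Suc (card ?U)"
    by (simp add: card_Suc_Diff1)
  ultimately show ?thesis
    by (metis mult_1_right power_Suc)
qed (simp add: zero_power)

lemma single_eq_zero_iff [simp]: "Poly_Mapping.single m c = 0 \<longleftrightarrow> c = 0"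
  by (metis lookup_single_eq lookup_zero single_zero)

lemma const_eq_zero_iff [simp]: "const c = 0 \<longleftrightarrow> c = 0"
  by (simp add: const_def)

section \<open>Additivity of the q-th power on polynomials\<close>

lemma CHAR_mpoly: "CHAR(('v, 'a::comm_ring_1) mpoly) = CHAR('a)"
  by (rule CHAR_eqI)
    (simp_all add: of_nat_eq_0_iff_char_dvd flip: single_of_nat)

text \<open>The prime in \<open>primepow\<close> is not tied to the field a priori. It equals the
  characteristic because that is itself a prime dividing the cardinality; additivity of powers is
  available for powers of the characteristic.\<close>

lemma primepow_card_eq_CHAR_power:
  assumes "primepow (CARD('a::{finite,field}))"
  obtains n where "CARD('a) = CHAR('a) ^ n"
proof -
  obtain p n where p: "prime p" "CARD('a) = p ^ n"
    using assms by (auto simp: primepow_def)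
  have "prime CHAR('a)"
    using finite_imp_CHAR_pos[where ?'a = 'a] prime_CHAR_semidom[where ?'a = 'a] by simp
  moreover have "CHAR('a) dvd p ^ n"
    using CHAR_dvd_CARD p(2) by metis
  ultimately have "CHAR('a) = p"
    using p(1) prime_dvd_power primes_dvd_imp_eq by blast
  then show ?thesis
    using that p(2) by simp
qed

lemma mpoly_power_card_add:
  fixes p r :: "('v, 'a::{finite,field}) mpoly"
  assumes "primepow (CARD('a))"
  shows "(p + r) ^ CARD('a) = p ^ CARD('a) + r ^ CARD('a)"
proof -
  obtain n where "CARD('a) = CHAR('a) ^ n"
    using primepow_card_eq_CHAR_power[OF assms] .
  moreover have "prime CHAR('a)"
    using finite_imp_CHAR_pos[where ?'a = 'a] prime_CHAR_semidom[where ?'a = 'a] by simp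
  ultimately show ?thesis
    by (intro freshmans_dream'[where n = n]) (simp_all add: CHAR_mpoly)
qed

section \<open>Finite quotients and zero-dimensionality\<close>

lemma finite_mpoly_keys_subset:
  assumes "finite M"
  shows "finite {p :: 'k \<Rightarrow>\<^sub>0 'b::{finite,zero}. Poly_Mapping.keys p \<subseteq> M}"
proof (rule finite_imageD)
  show "finite (Poly_Mapping.lookup ` {p :: 'k \<Rightarrow>\<^sub>0 'b. Poly_Mapping.keys p \<subseteq> M})"
    by (rule finite_subset[OF _ finite_set_of_finite_funs[OF assms finite[of UNIV], of 0]])
      (auto simp: in_keys_iff)
qed (simp add: inj_on_def)

lemma finite_bounded_monomials:
  assumes "finite V"
  shows "finite {m :: 'v \<Rightarrow>\<^sub>0 nat. Poly_Mapping.keys m \<subseteq> V \<and> (\<forall>v. Poly_Mapping.lookup m v < q)}"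
proof (rule finite_imageD)
  show "finite (Poly_Mapping.lookup ` {m :: 'v \<Rightarrow>\<^sub>0 nat. Poly_Mapping.keys m \<subseteq> V \<and>
      (\<forall>v. Poly_Mapping.lookup m v < q)})"
    by (rule finite_subset[OF _ finite_set_of_finite_funs[OF assms finite_lessThan[of q], of 0]])
      (auto simp: in_keys_iff)
qed (simp add: inj_on_def)

text \<open>A finite quotient is spanned by the list of all its elements. What needs work is that
  the classes of constants form a subfield, since spans and dimensions are taken over a
  subfield.\<close>

lemma finite_quotient_imp_zero_dimensional:
  fixes I :: "('v, 'a::field) mpoly set"
  assumes I: "ideal I (mpoly_ring V)" and fin: "finite (carrier (mpoly_ring V Quot I))"
  shows "zero_dimensional V I"
proof -
  let ?R = "mpoly_ring V :: ('v, 'a) mpoly ring"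
  let ?Q = "?R Quot I"
  let ?K = "range (\<lambda>c. I +>\<^bsub>?R\<^esub> const c)"
  interpret Q: ring ?Q
    by (rule ideal.quotient_is_ring[OF I])
  have "Q.finite_dimension ?K (carrier ?Q)"
  proof (cases "\<one>\<^bsub>?Q\<^esub> = \<zero>\<^bsub>?Q\<^esub>")
    \<comment> \<open>In the zero ring the classes of constants collapse to {0}, so dimension 0 is
      given directly. In the other case 1 and 0 differ, which is what makes the image of the field
      of constants a field.\<close>
    case True
    then have "carrier ?Q = {\<zero>\<^bsub>?Q\<^esub>}"
      using Q.one_zeroD by auto
    then show ?thesis
      using Q.zero_dim[of ?K] Q.finite_dimensionI by metis
  next
    case False
    have "subfield (range const) ?R"
    proof (rule MP.subfieldI)
      show sub: "subcring (range const) ?R"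
      proof (rule MP.subcringI'[OF MP.subringI])
        fix a assume a: "a \<in> range (const :: 'a \<Rightarrow> ('v, 'a) mpoly)"
        then have "\<ominus>\<^bsub>?R\<^esub> a = - a"
          by (intro MP.minus_equality) auto
        then show "\<ominus>\<^bsub>?R\<^esub> a \<in> range const"
          using a by (auto simp flip: const_uminus)
      qed (auto simp flip: const_add const_mult const_one)
      have inv: "const c * const (inverse c) = (1 :: ('v, 'a) mpoly)" if "c \<noteq> 0" for c :: 'a
        using that by (simp flip: const_mult)
      show "Units (?R\<lparr>carrier := range const\<rparr>) = range const - {\<zero>\<^bsub>?R\<^esub>}"
      proof (intro equalityI subsetI)
        fix a assume "a \<in> range const - {\<zero>\<^bsub>?R\<^esub>}"
        then obtain c where "a = const c" "c \<noteq> 0"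
          by auto
        then show "a \<in> Units (?R\<lparr>carrier := range const\<rparr>)"
          using inv[of c] by (auto simp: Units_def mult.commute)
      qed (auto simp: Units_def)
    qed
    then have "subfield ((+>\<^bsub>?R\<^esub>) I ` range const) ?Q"
      by (rule ring_hom_ring.img_is_subfield(2)[OF ideal.rcos_ring_hom_ring[OF I] _ False])
    then have K: "subfield ?K ?Q"
      by (simp add: image_image)
    obtain Us where Us: "set Us = carrier ?Q"
      using finite_list[OF fin] by blast
    have "Q.Span ?K Us = carrier ?Q"
      using Q.Span_in_carrier[of ?K Us] Q.Span_base_incl[OF K, of Us] subfieldE(3)[OF K] Us by simp
    then show ?thesis
      using Q.Span_finite_dimension[OF K, of Us] Us by simp
  qed
  then show ?thesis
    by (simp add: zero_dimensional_def)
qed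

section \<open>Consequences of the field equations\<close>

context
  fixes V :: "'v set" and I :: "('v, 'a::{finite,field}) mpoly set" and q :: nat
  assumes I: "ideal I (mpoly_ring V)" and V: "finite V"
    and q: "q = CARD('a)" "primepow q"
    and field_eq: "\<And>v. v \<in> V \<Longrightarrow> var v ^ q - var v \<in> I"
begin

lemma q_gt_1: "q > 1"
  using q(2) primepow_gt_Suc_0 by simp

lemma power_card_minus_self_in_ideal:
  assumes "p \<in> carrier (mpoly_ring V)"
  shows "p ^ q - p \<in> I"
  using assms
proof (induction rule: mpoly_carrier_induct)
  case (const c)
  then show ?case
    using finite_field_power_card[of c] ideal_zero[OF I] by (simp add: q(1) flip: const_power)
next
  case (var v)
  then show ?case
    by (rule field_eq)
next
  case (add p r)
  have "(p + r) ^ q - (p + r) = (p ^ q - p) + (r ^ q - r)"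
    using mpoly_power_card_add[of p r] q by simp
  then show ?case
    using add ideal_add[OF I] by metis
next
  case (mult p r)
  have "(p * r) ^ q - p * r = p ^ q * (r ^ q - r) + r * (p ^ q - p)"
    by (simp add: algebra_simps)
  then show ?case
    using mult ideal_add[OF I] ideal_mult[OF I] power_carrier by metis
qed

lemma radical_ideal_if_field_equations: "radical_ideal I (mpoly_ring V)"
  unfolding radical_ideal_def
proof (intro conjI ballI allI impI)
  show "ideal I (mpoly_ring V)"
    by (rule I)
next
  fix p :: "('v, 'a) mpoly" and n :: nat
  assume p: "p \<in> carrier (mpoly_ring V)" and "p [^]\<^bsub>mpoly_ring V\<^esub> n \<in> I"
  then have pn: "p ^ n \<in> I"
    by (simp add: pow_mpoly_ring)
  \<comment> \<open>Iterating the q-th power pushes the exponent past n: since n \<le> q^n, the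
    element p^(q^n) is a multiple of p^n and so lies in I, and it is congruent to p.\<close>
  have "p ^ (q ^ k) - p \<in> I" for k
  proof (induction k)
    case (Suc k)
    have "p ^ (q ^ Suc k) - p = ((p ^ (q ^ k)) ^ q - p ^ (q ^ k)) + (p ^ (q ^ k) - p)"
      by (simp add: mult.commute flip: power_mult)
    then show ?case
      using Suc ideal_add[OF I] power_card_minus_self_in_ideal power_carrier[OF p] by metis
  qed (simp add: ideal_zero[OF I])
  from this[of n] have *: "p ^ (q ^ n) - p \<in> I" .
  have "n \<le> q ^ n"
    using power_gt_expt[of q n] q_gt_1 by simp
  then have "p ^ (q ^ n) = p ^ (q ^ n - n) * p ^ n"
    by (simp flip: power_add)
  then have "p ^ (q ^ n) \<in> I"
    using ideal_mult[OF I power_carrier[OF p] pn] by simp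
  from ideal_diff[OF I this *] show "p \<in> I"
    by simp
qed

text \<open>Trading a factor v^q for v lowers the total degree by q - 1 > 0, so the process ends.
  The coefficient is quantified last, so the reduced monomial depends on \<open>m\<close> alone and
  can be chosen as a function of it.\<close>

lemma monomial_reduction:
  assumes "Poly_Mapping.keys m \<subseteq> V"
  shows "\<exists>m'. Poly_Mapping.keys m' \<subseteq> V \<and> (\<forall>v. Poly_Mapping.lookup m' v < q) \<and>
    (\<forall>c. Poly_Mapping.single m c - Poly_Mapping.single m' c \<in> I)"
  using assms
proof (induction "\<Sum>v\<in>V. Poly_Mapping.lookup m v" arbitrary: m rule: less_induct)
  case (less m)
  show ?case
  proof (cases "\<forall>v. Poly_Mapping.lookup m v < q")
    case True
    then show ?thesis
      using less.prems ideal_zero[OF I] by (intro exI[of _ m]) simp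
  next
    case False
    then obtain v where v: "Poly_Mapping.lookup m v \<ge> q"
      by (auto simp: not_less)
    with q_gt_1 have vV: "v \<in> V"
      using less.prems by (auto simp: in_keys_iff subset_iff)
    define n where "n = m - Poly_Mapping.single v q"
    have m: "m = n + Poly_Mapping.single v q"
      using v by (intro poly_mapping_eqI)
        (auto simp: n_def lookup_add lookup_minus lookup_single when_def)
    let ?m = "n + Poly_Mapping.single v 1"
    have n: "Poly_Mapping.keys n \<subseteq> V"
      using less.prems by (auto simp: n_def in_keys_iff lookup_minus subset_iff)
    have keys: "Poly_Mapping.keys ?m \<subseteq> V"
      using keys_add[of n "Poly_Mapping.single v 1"] n vV by auto
    have "(\<Sum>w\<in>V. Poly_Mapping.lookup ?m w) < (\<Sum>w\<in>V. Poly_Mapping.lookup m w)"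
      unfolding m using vV V q_gt_1 by (simp add: lookup_add sum.distrib lookup_single when_def)
    from less.hyps[OF this keys] obtain m' where m': "Poly_Mapping.keys m' \<subseteq> V"
      "\<forall>v. Poly_Mapping.lookup m' v < q"
      "\<And>c. Poly_Mapping.single ?m c - Poly_Mapping.single m' c \<in> I"
      by blast
    have "Poly_Mapping.single m c - Poly_Mapping.single m' c \<in> I" for c
    proof -
      have "Poly_Mapping.single n c * (var v ^ q - var v) \<in> I"
        using n vV by (intro ideal_mult[OF I] field_eq) (auto simp: carrier_mpoly_ring)
      moreover have "Poly_Mapping.single n c * (var v ^ q - var v) =
          Poly_Mapping.single m c - Poly_Mapping.single ?m c"
        unfolding m var_power by (simp add: var_def right_diff_distrib mult_single)
      ultimately show ?thesis
        using ideal_add[OF I _ m'(3)[of c]] by fastforce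
    qed
    with m' show ?thesis
      by blast
  qed
qed

lemma zero_dimensional_if_field_equations: "zero_dimensional V I"
proof (rule finite_quotient_imp_zero_dimensional[OF I])
  let ?R = "mpoly_ring V :: ('v, 'a) mpoly ring"
  define M where "M = {m. Poly_Mapping.keys m \<subseteq> V \<and> (\<forall>v. Poly_Mapping.lookup m v < q)}"
  obtain red where red: "\<And>m. Poly_Mapping.keys m \<subseteq> V \<Longrightarrow> red m \<in> M"
    "\<And>m c. Poly_Mapping.keys m \<subseteq> V \<Longrightarrow> Poly_Mapping.single m c - Poly_Mapping.single (red m) c \<in> I"
  proof -
    have "\<forall>m. \<exists>m'. Poly_Mapping.keys m \<subseteq> V \<longrightarrow> m' \<in> M \<and>
        (\<forall>c. Poly_Mapping.single m c - Poly_Mapping.single m' c \<in> I)"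
      using monomial_reduction by (simp add: M_def)
    then show ?thesis
      using that choice[of "\<lambda>m m'. Poly_Mapping.keys m \<subseteq> V \<longrightarrow> m' \<in> M \<and>
        (\<forall>c. Poly_Mapping.single m c - Poly_Mapping.single m' c \<in> I)"] by blast
  qed
  have "carrier (?R Quot I) \<subseteq> (+>\<^bsub>?R\<^esub>) I ` {p. Poly_Mapping.keys p \<subseteq> M}"
  proof
    fix A assume "A \<in> carrier (?R Quot I)"
    then obtain p where p: "p \<in> carrier ?R" "A = I +>\<^bsub>?R\<^esub> p"
      by (auto simp: FactRing_def A_RCOSETS_def')
    \<comment> \<open>Different monomials may reduce to the same one, so the reduced polynomial is
      written as a sum of terms, which adds up their coefficients.\<close>
    define r where "r = (\<Sum>m\<in>Poly_Mapping.keys p. Poly_Mapping.single (red m) (Poly_Mapping.lookup p m))"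
    have "Poly_Mapping.keys r \<subseteq> (\<Union>m\<in>Poly_Mapping.keys p.
        Poly_Mapping.keys (Poly_Mapping.single (red m) (Poly_Mapping.lookup p m)))"
      unfolding r_def by (rule Poly_Mapping.keys_sum)
    also have "\<dots> \<subseteq> M"
      using p(1) red(1) by (auto simp: carrier_mpoly_ring)
    finally have r: "Poly_Mapping.keys r \<subseteq> M" .
    then have r_carrier: "r \<in> carrier ?R"
      by (auto simp: carrier_mpoly_ring M_def)
    have "p - r = (\<Sum>m\<in>Poly_Mapping.keys p.
        Poly_Mapping.single m (Poly_Mapping.lookup p m) - Poly_Mapping.single (red m) (Poly_Mapping.lookup p m))"
      by (simp add: r_def sum_subtractf flip: poly_mapping_eq_sum_single)
    also have "\<dots> \<in> I"
      using p(1) red(2) by (intro ideal_sum[OF I]) (auto simp: carrier_mpoly_ring)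
    finally have "I +>\<^bsub>?R\<^esub> p = I +>\<^bsub>?R\<^esub> r"
      using MP.quotient_eq_iff_same_a_r_cos[OF I p(1) r_carrier] minus_mpoly_ring[OF p(1) r_carrier] by simp
    with p(2) r show "A \<in> (+>\<^bsub>?R\<^esub>) I ` {p. Poly_Mapping.keys p \<subseteq> M}"
      by blast
  qed
  moreover have "finite M"
    unfolding M_def by (rule finite_bounded_monomials[OF V])
  ultimately show "finite (carrier (?R Quot I))"
    by (rule finite_subset[OF _ finite_imageI[OF finite_mpoly_keys_subset]])
qed

end

section \<open>Permutation polynomials in one variable\<close>

text \<open>A nonzero polynomial of degree below q cannot vanish at all q field elements. This
  passes from identities between functions to identities between coefficients.\<close>

lemma polynomial_function_eq_zeroD:
  fixes c :: "nat \<Rightarrow> 'a::{finite,field}"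
  assumes "\<And>y. (\<Sum>j<CARD('a). c j * y ^ j) = 0" and "j < CARD('a)"
  shows "c j = 0"
proof -
  define P where "P = (\<Sum>j<CARD('a). Polynomial.monom (c j) j)"
  have P_coeff: "Polynomial.coeff P i = (if i < CARD('a) then c i else 0)" for i
    by (simp add: P_def coeff_sum)
  have "poly P y = 0" for y
    using assms(1)[of y] by (simp add: P_def poly_sum poly_monom)
  then have "{y. poly P y = 0} = UNIV"
    by simp
  moreover have "Polynomial.degree P < CARD('a)"
    by (rule degree_lessI) (simp_all add: P_coeff)
  ultimately have "P = 0"
    using card_poly_roots_bound[of P] by force
  then show ?thesis
    using P_coeff[of j] assms(2) by simp
qed

lemma power_card_minus_one_eq_one_iff:
  fixes x :: "'a::{finite,field}"
  shows "x ^ (CARD('a) - 1) = 1 \<longleftrightarrow> x \<noteq> 0"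
proof (cases "x = 0")
  case True
  have "card {0, 1 :: 'a} \<le> CARD('a)"
    by (rule card_mono) auto
  then have "CARD('a) - 1 > 0"
    by simp
  then show ?thesis
    using True by (simp add: zero_power)
next
  case False
  have "x * x ^ (CARD('a) - 1) = x"
    using finite_field_power_card[of x] by (metis power_minus_mult mult.commute zero_less_card_finite)
  with False show ?thesis
    by simp
qed

text \<open>For i > 0, X^i - 1 has at most i roots, fewer than the q - 1 nonzero elements, so c^i
  \<noteq> 1 for some nonzero c. Substituting c * t for t multiplies the sum by c^i without changing
  it. For i = 0 every summand is 1, including 0^0, and the sum is q = 0.\<close>

lemma sum_power_eq_zero:
  assumes "i < CARD('a) - 1"
  shows "(\<Sum>t\<in>UNIV. t ^ i) = (0 :: 'a::{finite,field})"
proof (cases "i = 0")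
  case True
  have "of_nat (CARD('a)) = (0 :: 'a)"
    using CHAR_dvd_CARD[where ?'a = 'a] by (simp only: of_nat_eq_0_iff_char_dvd)
  with True show ?thesis
    by simp
next
  case False
  define P where "P = Polynomial.monom (1 :: 'a) i - 1"
  have "Polynomial.coeff P 0 \<noteq> 0"
    using False by (simp add: P_def)
  then have "P \<noteq> 0"
    by auto
  have "Polynomial.degree P \<le> i"
    unfolding P_def by (rule degree_diff_le) (simp_all add: degree_monom_le)
  then have "card {x. poly P x = 0} < CARD('a) - 1"
    using card_poly_roots_bound[OF \<open>P \<noteq> 0\<close>] assms by linarith
  also have "CARD('a) - 1 = card (UNIV - {0 :: 'a})"
    by (simp add: card_Diff_singleton)
  finally have "\<not> UNIV - {0 :: 'a} \<subseteq> {x. poly P x = 0}"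
    using card_mono[of "{x. poly P x = 0}" "UNIV - {0}"] by fastforce
  then obtain c :: 'a where c: "c \<noteq> 0" "c ^ i \<noteq> 1"
    by (auto simp: P_def poly_monom)
  let ?S = "\<Sum>t\<in>UNIV. t ^ i :: 'a"
  have "bij ((*) c)"
    using c(1) by (intro bij_betw_byWitness[where f' = "\<lambda>y. y / c"]) auto
  then have "?S = (\<Sum>t\<in>UNIV. (c * t) ^ i)"
    using sum.reindex_bij_betw[of "(*) c" UNIV UNIV "\<lambda>t. t ^ i"] by simp
  also have "\<dots> = c ^ i * ?S"
    by (simp add: power_mult_distrib sum_distrib_left)
  finally show ?thesis
    using c(2) by simp
qed

text \<open>The summand is 1 at the nonzero elements and 0 at 0, so the sum is q - 1 = -1.\<close>

lemma sum_power_card_minus_one: "(\<Sum>t\<in>UNIV. t ^ (CARD('a) - 1)) = (- 1 :: 'a::{finite,field})"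
proof -
  have card: "CARD('a) = Suc (card (UNIV - {0 :: 'a}))"
    by (simp only: card_Suc_Diff1 finite UNIV_I)
  have "(\<Sum>t\<in>UNIV. t ^ (CARD('a) - 1)) = (\<Sum>t\<in>UNIV - {0 :: 'a}. 1 :: 'a)"
    using power_card_minus_one_eq_one_iff[of "0 :: 'a"] power_card_minus_one_eq_one_iff[where ?'a = 'a]
    by (intro sum.mono_neutral_cong_right) (auto simp: power_0_left split: if_splits)
  also have "\<dots> = of_nat (card (UNIV - {0 :: 'a}))"
    by simp
  also have "\<dots> = of_nat (CARD('a)) - 1"
    unfolding card by simp
  also have "of_nat (CARD('a)) = (0 :: 'a)"
    using CHAR_dvd_CARD[where ?'a = 'a] by (simp only: of_nat_eq_0_iff_char_dvd)
  finally show ?thesis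
    by simp
qed

lemma permutation_polynomial_top_coeff:
  fixes c :: "nat \<Rightarrow> 'a::{finite,field}"
  assumes "bij (\<lambda>t. \<Sum>i<CARD('a). c i * t ^ i)" and "CARD('a) > 2"
  shows "c (CARD('a) - 1) = 0"
proof -
  let ?q = "CARD('a)"
  have split: "{..<?q} = insert (?q - 1) {..<?q - 1}"
    using assms(2) by auto
  have "(\<Sum>t\<in>UNIV. \<Sum>i<?q. c i * t ^ i) = (\<Sum>i<?q. c i * (\<Sum>t\<in>UNIV. t ^ i))"
    by (subst sum.swap) (simp add: sum_distrib_left)
  also have "\<dots> = - c (?q - 1)"
    unfolding split by (simp add: sum_power_card_minus_one sum_power_eq_zero del: One_nat_def)
  \<comment> \<open>A permutation only reorders the values, so their sum is the sum of all field
    elements.\<close>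
  also have "(\<Sum>t\<in>UNIV. \<Sum>i<?q. c i * t ^ i) = (\<Sum>t\<in>UNIV. t ^ 1 :: 'a)"
    using sum.reindex_bij_betw[OF assms(1), of "\<lambda>t. t"] by simp
  \<comment> \<open>The exponent 1 is below q - 1 because q > 2; over the field with two elements
    the sum would be 1.\<close>
  also have "\<dots> = 0"
    using assms(2) by (intro sum_power_eq_zero) simp
  finally show ?thesis
    by simp
qed


section \<open>Bivariate polynomials\<close>

text \<open>Exponent vectors on \<open>xy\<close> correspond one-to-one to pairs of exponents, so
  supports of bivariate polynomials can be compared with \<open>idx q\<close>.\<close>

definition mxy :: "nat \<times> nat \<Rightarrow> (xy \<Rightarrow>\<^sub>0 nat)" where
  "mxy ij = Poly_Mapping.single X (fst ij) + Poly_Mapping.single Y (snd ij)"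

lemma lookup_mxy [simp]:
  "Poly_Mapping.lookup (mxy ij) X = fst ij" "Poly_Mapping.lookup (mxy ij) Y = snd ij"
  by (simp_all add: mxy_def lookup_add lookup_single)

lemma mxy_eq_iff [simp]: "mxy ij = mxy kl \<longleftrightarrow> ij = kl"
  by (metis lookup_mxy prod_eqI)

lemma mxy_lookup: "mxy (Poly_Mapping.lookup m X, Poly_Mapping.lookup m Y) = m"
proof (rule poly_mapping_eqI)
  fix v show "Poly_Mapping.lookup (mxy (Poly_Mapping.lookup m X, Poly_Mapping.lookup m Y)) v
    = Poly_Mapping.lookup m v"
    by (cases v) simp_all
qed

lemma in_mxy_image_iff:
  "m \<in> mxy ` A \<longleftrightarrow> (Poly_Mapping.lookup m X, Poly_Mapping.lookup m Y) \<in> A"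
  by (metis imageE image_eqI lookup_mxy mxy_lookup prod.collapse)

lemma sum_keys_mxy: "(\<Sum>v\<in>Poly_Mapping.keys (mxy ij). Poly_Mapping.lookup (mxy ij) v) = fst ij + snd ij"
proof -
  have "(\<Sum>v\<in>Poly_Mapping.keys (mxy ij). Poly_Mapping.lookup (mxy ij) v)
      = (\<Sum>v\<in>{X, Y}. Poly_Mapping.lookup (mxy ij) v)"
    by (rule sum.mono_neutral_left) (auto simp: in_keys_iff intro: xy.exhaust)
  then show ?thesis
    by simp
qed

lemma mon_mxy: "mon \<sigma> (mxy ij) = \<sigma> X ^ fst ij * \<sigma> Y ^ snd ij"
  by (simp add: mxy_def mon_add mon_single)

lemma (in coeff_hom) ev_xy:
  assumes "finite A" "Poly_Mapping.keys f \<subseteq> mxy ` A"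
  shows "ev h \<sigma> f = (\<Sum>(i, j)\<in>A. h (Poly_Mapping.lookup f (mxy (i, j))) * (\<sigma> X ^ i * \<sigma> Y ^ j))"
proof -
  have "ev h \<sigma> f = (\<Sum>m\<in>mxy ` A. h (Poly_Mapping.lookup f m) * mon \<sigma> m)"
    using assms by (intro ev_superset) auto
  also have "\<dots> = (\<Sum>ij\<in>A. h (Poly_Mapping.lookup f (mxy ij)) * mon \<sigma> (mxy ij))"
    by (subst sum.reindex) (auto simp: inj_on_def)
  finally show ?thesis
    by (simp add: mon_mxy case_prod_unfold)
qed

lemma deg_in_less_iff:
  assumes "q > 0"
  shows "deg_in v f < q \<longleftrightarrow> (\<forall>m\<in>Poly_Mapping.keys f. Poly_Mapping.lookup m v < q)"
  using assms by (simp add: deg_in_def)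

lemma keys_subset_if_deg_in:
  assumes "deg_in X f < q" "deg_in Y f < q"
  shows "Poly_Mapping.keys f \<subseteq> mxy ` ({..<q} \<times> {..<q})"
proof -
  have "q > 0"
    using assms(1) by simp
  then show ?thesis
    using assms by (auto simp: in_mxy_image_iff deg_in_less_iff)
qed

lemma finite_idx [simp]: "finite (idx q)"
  by (simp add: idx_def)

text \<open>\<open>LP\<close> admits exponents up to q - 1, while points only carry coefficients up
  to q - 2. For each a, f(t,a) permutes the field, so its coefficient at t^(q-1) is 0. That
  coefficient is a polynomial in a of degree below q vanishing everywhere, so all its coefficients
  are 0. The other variable is symmetric.\<close>

lemma LP_keys_subset:
  assumes "f \<in> LP (CARD('a))" and "CARD('a::{finite,field}) > 2"
  shows "Poly_Mapping.keys (f :: (xy, 'a) mpoly) \<subseteq> mxy ` idx (CARD('a))"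
proof
  let ?q = "CARD('a)"
  let ?l = "\<lambda>i j. Poly_Mapping.lookup f (mxy (i, j))"
  from assms(1) have deg: "deg_in X f < ?q" "deg_in Y f < ?q"
    and bij: "\<And>a. bij (\<lambda>t. eval_at (case_xy t a) f)" "\<And>a. bij (\<lambda>t. eval_at (case_xy a t) f)"
    by (auto simp: LP_def)
  note keys = keys_subset_if_deg_in[OF deg]
  have eval: "eval_at (case_xy a b) f = (\<Sum>i<?q. \<Sum>j<?q. ?l i j * (a ^ i * b ^ j))" for a b
    unfolding eval_at_eq_ev by (subst eval.ev_xy[OF _ keys]) (simp_all add: sum.cartesian_product)
  have "eval_at (case_xy t a) f = (\<Sum>i<?q. (\<Sum>j<?q. ?l i j * a ^ j) * t ^ i)" for t a
    by (simp add: eval sum_distrib_left mult_ac)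
  then have "(\<Sum>j<?q. ?l (?q - 1) j * a ^ j) = 0" for a
    using permutation_polynomial_top_coeff[of "\<lambda>i. \<Sum>j<?q. ?l i j * a ^ j"] bij(1)[of a] assms(2) by simp
  then have X0: "?l (?q - 1) j = 0" if "j < ?q" for j
    using polynomial_function_eq_zeroD[of "?l (?q - 1)"] that by blast
  have "eval_at (case_xy a t) f = (\<Sum>j<?q. (\<Sum>i<?q. ?l i j * a ^ i) * t ^ j)" for t a
    unfolding eval by (subst sum.swap) (simp add: sum_distrib_left mult_ac)
  then have "(\<Sum>i<?q. ?l i (?q - 1) * a ^ i) = 0" for a
    using permutation_polynomial_top_coeff[of "\<lambda>j. \<Sum>i<?q. ?l i j * a ^ i"] bij(2)[of a] assms(2) by simp
  then have Y0: "?l i (?q - 1) = 0" if "i < ?q" for i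
    using polynomial_function_eq_zeroD[of "\<lambda>i. ?l i (?q - 1)"] that by blast
  fix m assume m: "m \<in> Poly_Mapping.keys f"
  with keys obtain i j where ij: "m = mxy (i, j)" "i < ?q" "j < ?q"
    by auto
  with m have "?l i j \<noteq> 0"
    by (simp add: in_keys_iff)
  with X0 Y0 ij have "i \<noteq> ?q - 1" "j \<noteq> ?q - 1"
    by metis+
  with ij show "m \<in> mxy ` idx ?q"
    by (auto simp: idx_def)
qed

section \<open>The polynomial attached to a point\<close>

lemma poly_of_point_eq_sum_single:
  "poly_of_point q s = (\<Sum>ij\<in>idx q. Poly_Mapping.single (mxy ij) (s ij))"
  by (simp add: poly_of_point_def var_power const_def mult_single mxy_def case_prod_unfold)

lemma lookup_poly_of_point:
  "Poly_Mapping.lookup (poly_of_point q s) (mxy ij) = (if ij \<in> idx q then s ij else 0)"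
  by (simp add: poly_of_point_eq_sum_single lookup_sum lookup_single when_def)

lemma keys_poly_of_point: "Poly_Mapping.keys (poly_of_point q s) \<subseteq> mxy ` idx q"
proof
  fix m assume "m \<in> Poly_Mapping.keys (poly_of_point q s)"
  then show "m \<in> mxy ` idx q"
    using lookup_poly_of_point[of q s "(Poly_Mapping.lookup m X, Poly_Mapping.lookup m Y)"]
    by (simp add: mxy_lookup in_keys_iff in_mxy_image_iff split: if_splits)
qed

text \<open>Reading off coefficients is the inverse map; the support condition on \<open>R\<close>
  makes it a right inverse. \<open>R\<close> stays open to cover both \<open>RLP\<close> and
  \<open>RLP_deg\<close>.\<close>

lemma bij_betw_poly_of_point:
  assumes "\<And>f. f \<in> R \<Longrightarrow> Poly_Mapping.keys f \<subseteq> mxy ` idx q"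
  shows "bij_betw (poly_of_point q) {s \<in> idx q \<rightarrow>\<^sub>E UNIV. poly_of_point q s \<in> R} R"
proof (rule bij_betwI')
  fix s t :: "nat \<times> nat \<Rightarrow> 'a"
  assume s: "s \<in> {s \<in> idx q \<rightarrow>\<^sub>E UNIV. poly_of_point q s \<in> R}"
    and t: "t \<in> {s \<in> idx q \<rightarrow>\<^sub>E UNIV. poly_of_point q s \<in> R}"
  have "s = t" if "poly_of_point q s = poly_of_point q t"
  proof -
    have "s ij = t ij" if "ij \<in> idx q" for ij
      using that lookup_poly_of_point[of q s ij] lookup_poly_of_point[of q t ij]
        \<open>poly_of_point q s = poly_of_point q t\<close> by simp
    then show ?thesis
      using s t by (intro PiE_ext[of s "idx q" "\<lambda>_. UNIV" t]) simp_all
  qed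
  then show "poly_of_point q s = poly_of_point q t \<longleftrightarrow> s = t"
    by blast
next
  fix f assume f: "f \<in> R"
  \<comment> \<open>Restriction makes the coefficient function \<open>undefined\<close> outside
    \<open>idx q\<close>, as points are required to be.\<close>
  let ?s = "restrict (\<lambda>ij. Poly_Mapping.lookup f (mxy ij)) (idx q)"
  have "poly_of_point q ?s = f"
  proof (rule poly_mapping_eqI)
    fix m
    obtain ij where m: "m = mxy ij"
      using mxy_lookup by metis
    show "Poly_Mapping.lookup (poly_of_point q ?s) m = Poly_Mapping.lookup f m"
      using assms[OF f] by (auto simp: m lookup_poly_of_point in_keys_iff)
  qed
  with f show "\<exists>s\<in>{s \<in> idx q \<rightarrow>\<^sub>E UNIV. poly_of_point q s \<in> R}. f = poly_of_point q s"
    by (intro bexI[of _ ?s]) auto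
qed auto

lemma ev_poly_of_point:
  "eval_at \<sigma> (poly_of_point q s) = (\<Sum>(i, j)\<in>idx q. s (i, j) * (\<sigma> X ^ i * \<sigma> Y ^ j))"
  unfolding eval_at_eq_ev by (subst eval.ev_xy[OF finite_idx keys_poly_of_point])
    (auto simp: lookup_poly_of_point intro!: sum.cong)

text \<open>The maximum defining \<open>total_deg\<close> includes an artificial 0. A nonzero
  coefficient of positive degree k + l ensures that the maximum is attained at an actual
  monomial.\<close>

lemma total_deg_poly_of_point:
  assumes "(k, l) \<in> idx q" "k + l > 0" "s (k, l) \<noteq> 0"
  shows "total_deg (poly_of_point q s) = d \<longleftrightarrow>
    (\<forall>i j. (i, j) \<in> idx q \<and> i + j > d \<longrightarrow> s (i, j) = 0) \<and>
    (\<exists>i j. (i, j) \<in> idx q \<and> i + j = d \<and> s (i, j) \<noteq> 0)"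
proof -
  define D where "D = {i + j | i j. (i, j) \<in> idx q \<and> s (i, j) \<noteq> 0}"
  have keys: "Poly_Mapping.keys (poly_of_point q s) = mxy ` {ij \<in> idx q. s ij \<noteq> 0}"
    using keys_poly_of_point[of q s] lookup_poly_of_point[of q s] by (auto simp: in_keys_iff)
  have "D = (\<lambda>ij. fst ij + snd ij) ` {ij \<in> idx q. s ij \<noteq> 0}"
    by (force simp: D_def)
  then have total: "total_deg (poly_of_point q s) = Max (insert 0 D)" and "finite D"
    by (simp_all add: total_deg_def keys image_image sum_keys_mxy)
  have kl: "k + l \<in> D"
    using assms by (auto simp: D_def)
  have "Max (insert 0 D) = d \<longleftrightarrow> d \<in> insert 0 D \<and> (\<forall>x\<in>insert 0 D. x \<le> d)"
    using \<open>finite D\<close> by (intro Max_eq_iff) auto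
  also have "\<dots> \<longleftrightarrow> d \<in> D \<and> (\<forall>x\<in>D. x \<le> d)"
    using kl assms(2) by force
  also have "\<dots> \<longleftrightarrow> (\<forall>i j. (i, j) \<in> idx q \<and> i + j > d \<longrightarrow> s (i, j) = 0) \<and>
      (\<exists>i j. (i, j) \<in> idx q \<and> i + j = d \<and> s (i, j) \<noteq> 0)"
    by (force simp: D_def not_less[symmetric])
  finally show ?thesis
    by (simp add: total)
qed

lemma univariate_eq_var_iff:
  assumes "n \<ge> 1"
  shows "(\<Sum>i\<le>n. const (c i) * var v ^ i) = var v \<longleftrightarrow>
    c 0 = 0 \<and> c 1 = 1 \<and> (\<forall>i. 2 \<le> i \<and> i \<le> n \<longrightarrow> c i = 0)"
proof
  assume *: "(\<Sum>i\<le>n. const (c i) * var v ^ i) = var v"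
  have "c k = (if k = 1 then 1 else 0)" if "k \<le> n" for k
  proof -
    have single: "Poly_Mapping.single v i = Poly_Mapping.single v j \<longleftrightarrow> i = j" for i j :: nat
      by (metis lookup_single_eq)
    have "c k = Poly_Mapping.lookup (\<Sum>i\<le>n. const (c i) * var v ^ i) (Poly_Mapping.single v k)"
      using that by (simp add: var_power const_def mult_single lookup_sum lookup_single when_def single)
    also have "\<dots> = (if k = 1 then 1 else 0)"
      unfolding * by (auto simp: var_def lookup_single when_def single)
    finally show ?thesis .
  qed
  then show "c 0 = 0 \<and> c 1 = 1 \<and> (\<forall>i. 2 \<le> i \<and> i \<le> n \<longrightarrow> c i = 0)"
    using assms by simp
next
  assume c: "c 0 = 0 \<and> c 1 = 1 \<and> (\<forall>i. 2 \<le> i \<and> i \<le> n \<longrightarrow> c i = 0)"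
  have "(\<Sum>i\<le>n. const (c i) * var v ^ i) = (\<Sum>i\<in>{1}. const (c i) * var v ^ i)"
  proof (rule sum.mono_neutral_right)
    show "\<forall>i\<in>{..n} - {1}. const (c i) * var v ^ i = 0"
    proof
      fix i assume "i \<in> {..n} - {1}"
      then have "i = 0 \<or> 2 \<le> i \<and> i \<le> n"
        by auto
      then show "const (c i) * var v ^ i = 0"
        using c by auto
    qed
  qed (use assms in auto)
  then show "(\<Sum>i\<le>n. const (c i) * var v ^ i) = var v"
    using c by simp
qed

lemma reduced_poly_of_point:
  assumes "q \<ge> 3"
  shows "reduced (poly_of_point q s) \<longleftrightarrow> s (0, 0) = 0 \<and> s (1, 0) = 1 \<and> s (0, 1) = 1 \<and>
    (\<forall>i. 2 \<le> i \<and> i \<le> q - 2 \<longrightarrow> s (0, i) = 0 \<and> s (i, 0) = 0)"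
proof -
  let ?f = "poly_of_point q s"
  have subst: "subst \<sigma> ?f = (\<Sum>i\<le>q - 2. \<Sum>j\<le>q - 2. const (s (i, j)) * (\<sigma> X ^ i * \<sigma> Y ^ j))"
    for \<sigma> :: "xy \<Rightarrow> (xy, 'a) mpoly"
    unfolding subst_eq_ev
    by (subst subst.ev_xy[OF finite_idx keys_poly_of_point])
      (auto simp: lookup_poly_of_point sum.cartesian_product idx_def atLeast0AtMost intro!: sum.cong)
  \<comment> \<open>Substituting 0 for one variable leaves exactly the terms with exponent 0 in it,
    because 0^0 = 1.\<close>
  have zero_power: "a * (b * 0 ^ j) = (if j = 0 then a * b else 0)"
    "a * (0 ^ j * b) = (if j = 0 then a * b else 0)" for a b :: "(xy, 'a) mpoly" and j :: nat
    by (simp_all add: power_0_left)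
  have "subst (case_xy (var X) 0) ?f = (\<Sum>i\<le>q - 2. const (s (i, 0)) * var X ^ i)"
    by (simp add: subst zero_power)
  moreover have "subst (case_xy 0 (var Y)) ?f = (\<Sum>j\<le>q - 2. const (s (0, j)) * var Y ^ j)"
    unfolding subst by (subst sum.swap) (simp add: zero_power)
  ultimately show ?thesis
    using assms by (auto simp: reduced_def univariate_eq_var_iff simp del: One_nat_def)
qed

lemma keys_subset_idx_imp_deg_in:
  assumes "Poly_Mapping.keys f \<subseteq> mxy ` idx q" "q \<ge> 2"
  shows "deg_in X f < q" "deg_in Y f < q"
  using assms by (fastforce simp: deg_in_less_iff idx_def in_mxy_image_iff)+

text \<open>Common form for the values of the polynomial of a point and for the arguments of F in
  the generators.\<close>

definition bivar :: "nat \<Rightarrow> (nat \<times> nat \<Rightarrow> 'a) \<Rightarrow> 'a \<Rightarrow> 'a \<Rightarrow> 'a::comm_ring_1" where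
  "bivar q s x y = (\<Sum>(i, j)\<in>idx q. s (i, j) * (x ^ i * y ^ j))"

lemma sum_idx_swap: "(\<Sum>(i, j)\<in>idx q. f i j) = (\<Sum>(i, j)\<in>idx q. f j i)"
  unfolding idx_def by (subst (1 2) sum.cartesian_product[symmetric]) (rule sum.swap)

text \<open>Injective self-maps of a finite field are bijective, so only inequations between values
  remain. The degree bounds hold because exponents in \<open>idx q\<close> stop at q - 2.\<close>

lemma poly_of_point_in_LP_iff:
  fixes s :: "nat \<times> nat \<Rightarrow> 'a::{finite,field}"
  assumes "q \<ge> 2"
  shows "poly_of_point q s \<in> LP q \<longleftrightarrow>
    (\<forall>a b c. a \<noteq> b \<longrightarrow> bivar q s c a \<noteq> bivar q s c b \<and> bivar q s a c \<noteq> bivar q s b c)"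
proof -
  have bij_iff: "bij g \<longleftrightarrow> (\<forall>a b. a \<noteq> b \<longrightarrow> g a \<noteq> g b)" for g :: "'a \<Rightarrow> 'a"
    using finite_UNIV_inj_surj[of g] by (auto simp: bij_def inj_def)
  have "eval_at (case_xy x y) (poly_of_point q s) = bivar q s x y" for x y
    by (simp add: ev_poly_of_point bivar_def)
  then show ?thesis
    using keys_subset_idx_imp_deg_in[OF keys_poly_of_point assms, of s]
    by (simp add: LP_def bij_iff) blast
qed

lemma F_eq_zero_iff: "F (CARD('a)) x = 0 \<longleftrightarrow> x \<noteq> (0 :: 'a::{finite,field})"
  by (simp add: F_def power_card_minus_one_eq_one_iff del: One_nat_def)

lemma eval_F: "eval_at s (F q p) = F q (eval_at s p)"
  by (simp add: F_def eval_at_eq_ev eval.ev_simps)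

text \<open>The transposed variable \<open>var (j, i)\<close> attaches the powers of a and b to the
  second exponent, so x is fixed at c and y varies; swapping the summation indices makes this
  visible.\<close>

lemma eval_G_row: "eval_at s (G_row q a b c) = F q (bivar q s c a - bivar q s c b)"
proof -
  have "(\<Sum>(i, j)\<in>idx q. ((a ^ i - b ^ i) * c ^ j) * s (j, i)) =
      (\<Sum>(i, j)\<in>idx q. s (i, j) * (c ^ i * a ^ j) - s (i, j) * (c ^ i * b ^ j))"
    by (subst sum_idx_swap) (simp add: algebra_simps)
  also have "\<dots> = bivar q s c a - bivar q s c b"
    by (simp add: bivar_def case_prod_unfold sum_subtractf)
  finally show ?thesis
    by (simp add: G_row_def eval_F) (simp add: eval_at_eq_ev eval.ev_simps case_prod_unfold)
qed

lemma eval_G_col: "eval_at s (G_col q a b c) = F q (bivar q s a c - bivar q s b c)"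
proof -
  have "(\<Sum>(i, j)\<in>idx q. ((a ^ i - b ^ i) * c ^ j) * s (i, j)) =
      (\<Sum>(i, j)\<in>idx q. s (i, j) * (a ^ i * c ^ j) - s (i, j) * (b ^ i * c ^ j))"
    by (simp add: algebra_simps)
  also have "\<dots> = bivar q s a c - bivar q s b c"
    by (simp add: bivar_def case_prod_unfold sum_subtractf)
  finally show ?thesis
    by (simp add: G_col_def eval_F) (simp add: eval_at_eq_ev eval.ev_simps case_prod_unfold)
qed


section \<open>The ideals of local permutation polynomials\<close>

lemma F_carrier: "p \<in> carrier (mpoly_ring V) \<Longrightarrow> F q p \<in> carrier (mpoly_ring V)"
  by (auto simp: F_def)

lemma J_gens_carrier:
  "{G_row q a b c | a b c. a \<noteq> b} \<union> {G_col q a b c | a b c. a \<noteq> b} \<subseteq> carrier (polring q)"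
proof -
  have "G_row q a b c \<in> carrier (polring q)" for a b c :: 'a
    unfolding G_row_def by (intro F_carrier sum_carrier) (auto intro!: mult_mpoly_carrier var_carrier simp: idx_def)
  moreover have "G_col q a b c \<in> carrier (polring q)" for a b c :: 'a
    unfolding G_col_def by (intro F_carrier sum_carrier) auto
  ultimately show ?thesis
    by auto
qed

lemma field_equations_carrier:
  "{var (i, j) ^ q - var (i, j) | i j. (i, j) \<in> idx q} \<subseteq> carrier (polring q)"
  by auto

lemma degree_gens_carrier:
  "{var (i, j) | i j. (i, j) \<in> idx q \<and> i + j > d} \<subseteq> carrier (polring q)"
  "{\<Prod>(i,j)\<in>{(i,j) \<in> idx q. i + j = d}. (var (i, j) ^ (q - 1) - 1)} \<subseteq> carrier (polring q)"
  by (auto intro!: prod_carrier)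

lemma reduced_gens_carrier:
  assumes "q \<ge> 3"
  shows "{var (0, 0), var (1, 0) - 1, var (0, 1) - 1} \<subseteq> carrier (polring q)"
    and "{var (0, i) | i. 2 \<le> i \<and> i \<le> q - 2} \<union> {var (i, 0) | i. 2 \<le> i \<and> i \<le> q - 2} \<subseteq> carrier (polring q)"
  using assms by (auto intro!: diff_carrier var_carrier simp: idx_def)

lemma ideal_J: "ideal (J q) (polring q)"
  unfolding J_def
  by (intro MP.add_ideals MP.genideal_ideal J_gens_carrier field_equations_carrier)

lemma ideal_J_deg: "ideal (J_deg q d) (polring q)"
  unfolding J_deg_def
  by (intro MP.add_ideals MP.genideal_ideal ideal_J degree_gens_carrier)

lemma ideal_add_reduced:
  assumes "q \<ge> 3" "ideal I (polring q)"
  shows "ideal (add_reduced q I) (polring q)"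
  unfolding add_reduced_def
  by (intro MP.add_ideals MP.genideal_ideal reduced_gens_carrier assms)

lemma set_add_ideals_supset:
  assumes "ideal I (mpoly_ring V)" "ideal L (mpoly_ring V)"
  shows "I \<subseteq> I <+>\<^bsub>mpoly_ring V\<^esub> L" "L \<subseteq> I <+>\<^bsub>mpoly_ring V\<^esub> L"
  using set_add_subset_ideal_iff[OF assms MP.add_ideals[OF assms]] by auto

lemma J_subset_J_deg: "J q \<subseteq> J_deg q d"
  unfolding J_deg_def
  by (rule subset_trans[OF set_add_ideals_supset(1) set_add_ideals_supset(1)];
      intro MP.add_ideals MP.genideal_ideal ideal_J degree_gens_carrier)

lemma subset_add_reduced:
  assumes "q \<ge> 3" "ideal I (polring q)"
  shows "I \<subseteq> add_reduced q I"
  unfolding add_reduced_def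
  by (rule subset_trans[OF set_add_ideals_supset(1) set_add_ideals_supset(1)];
      intro MP.add_ideals MP.genideal_ideal reduced_gens_carrier assms)

lemma field_equation_in_J: "v \<in> idx q \<Longrightarrow> var v ^ q - var v \<in> J q"
  using MP.genideal_self[OF field_equations_carrier, of q]
    set_add_ideals_supset(2)[OF MP.genideal_ideal[OF J_gens_carrier] MP.genideal_ideal[OF field_equations_carrier], of q]
  unfolding J_def by (cases v) blast

section \<open>The generators as conditions on a point\<close>

context
  fixes q :: nat and vanish :: "(nat \<times> nat \<Rightarrow> 'a) \<Rightarrow> (nat \<times> nat, 'a::{finite,field}) mpoly set"
  assumes q: "q = CARD('a)" "q > 3"
  defines "vanish s \<equiv> {p \<in> carrier (polring q). eval_at s p = 0}"
begin

text \<open>The field equations hold at every point over the field, so only the \<open>G_row\<close>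
  and \<open>G_col\<close> constrain \<open>s\<close>, and they state separation in each
  variable.\<close>

lemma J_vanishes_iff: "J q \<subseteq> vanish s \<longleftrightarrow> poly_of_point q s \<in> LP q"
proof -
  let ?A = "{G_row q a b c | a b c. a \<noteq> b} \<union> {G_col q a b c | a b c. a \<noteq> b} :: (nat \<times> nat, 'a) mpoly set"
  let ?B = "{var (i, j) ^ q - var (i, j) | i j. (i, j) \<in> idx q} :: (nat \<times> nat, 'a) mpoly set"
  have "J q \<subseteq> vanish s \<longleftrightarrow> (\<forall>p\<in>?A. eval_at s p = 0) \<and> (\<forall>p\<in>?B. eval_at s p = 0)"
    unfolding J_def vanish_def
    by (simp only: set_add_subset_ideal_iff[OF MP.genideal_ideal[OF J_gens_carrier]
          MP.genideal_ideal[OF field_equations_carrier] ideal_vanishing]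
        Idl_subset_vanishing[OF J_gens_carrier] Idl_subset_vanishing[OF field_equations_carrier])
  moreover have "eval_at s (var v ^ q - var v) = 0" for v
    using finite_field_power_card[of "s v"] q(1) by (simp add: eval_at_eq_ev eval.ev_simps)
  then have "\<forall>p\<in>?B. eval_at s p = 0"
    by blast
  moreover have "(\<forall>p\<in>?A. eval_at s p = 0) \<longleftrightarrow> (\<forall>a b c. a \<noteq> b \<longrightarrow>
      eval_at s (G_row q a b c) = 0 \<and> eval_at s (G_col q a b c) = 0)"
    by blast
  moreover have "\<dots> \<longleftrightarrow>
      (\<forall>a b c. a \<noteq> b \<longrightarrow> bivar q s c a \<noteq> bivar q s c b \<and> bivar q s a c \<noteq> bivar q s b c)"
    by (simp add: eval_G_row eval_G_col q(1) F_eq_zero_iff)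
  moreover have "\<dots> \<longleftrightarrow> poly_of_point q s \<in> LP q"
    using q(2) by (simp only: poly_of_point_in_LP_iff)
  ultimately show ?thesis
    by argo
qed

text \<open>The product vanishes when some factor does, that is, when some s_ij with i + j = d is
  nonzero. If no index has that sum, the product is 1 and both sides are false.\<close>

lemma J_deg_vanishes_iff: "J_deg q d \<subseteq> vanish s \<longleftrightarrow> poly_of_point q s \<in> LP q \<and>
    (\<forall>i j. (i, j) \<in> idx q \<and> i + j > d \<longrightarrow> s (i, j) = 0) \<and>
    (\<exists>i j. (i, j) \<in> idx q \<and> i + j = d \<and> s (i, j) \<noteq> 0)"
proof -
  let ?A = "{var (i, j) :: (nat \<times> nat, 'a) mpoly | i j. (i, j) \<in> idx q \<and> i + j > d}"
  let ?D = "{(i, j) \<in> idx q. i + j = d}"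
  let ?B = "{\<Prod>(i, j)\<in>?D. (var (i, j) ^ (q - 1) - 1) :: (nat \<times> nat, 'a) mpoly}"
  note A = MP.genideal_ideal[OF degree_gens_carrier(1), of q d]
    and B = MP.genideal_ideal[OF degree_gens_carrier(2), of q d]
  have "eval_at s (\<Prod>(i, j)\<in>?D. var (i, j) ^ (q - 1) - 1) = (\<Prod>ij\<in>?D. s ij ^ (q - 1) - 1)"
    by (simp add: eval_at_eq_ev eval.ev_simps case_prod_unfold)
  moreover have "finite ?D"
    by (rule finite_subset[OF _ finite_idx[of q]]) auto
  ultimately have "eval_at s (\<Prod>(i, j)\<in>?D. var (i, j) ^ (q - 1) - 1) = 0 \<longleftrightarrow>
      (\<exists>i j. (i, j) \<in> idx q \<and> i + j = d \<and> s (i, j) \<noteq> 0)"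
    using power_card_minus_one_eq_one_iff[where ?'a = 'a] q(1) by (auto simp del: One_nat_def)
  moreover have "J_deg q d \<subseteq> vanish s \<longleftrightarrow> J q \<subseteq> vanish s \<and> (\<forall>p\<in>?A. eval_at s p = 0) \<and> (\<forall>p\<in>?B. eval_at s p = 0)"
    unfolding J_deg_def vanish_def
    by (simp only: set_add_subset_ideal_iff[OF MP.add_ideals[OF ideal_J A] B ideal_vanishing]
        set_add_subset_ideal_iff[OF ideal_J A ideal_vanishing] conj_assoc
        Idl_subset_vanishing[OF degree_gens_carrier(1)] Idl_subset_vanishing[OF degree_gens_carrier(2)])
  moreover have "(\<forall>p\<in>?A. eval_at s p = 0) \<longleftrightarrow> (\<forall>i j. (i, j) \<in> idx q \<and> i + j > d \<longrightarrow> eval_at s (var (i, j)) = 0)"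
    by blast
  moreover have "eval_at s (var v) = s v" for v
    by (simp add: eval_at_eq_ev)
  ultimately show ?thesis
    by (simp add: J_vanishes_iff)
qed

lemma add_reduced_vanishes_iff:
  assumes "ideal I (polring q)"
  shows "add_reduced q I \<subseteq> vanish s \<longleftrightarrow> I \<subseteq> vanish s \<and> reduced (poly_of_point q s)"
proof -
  let ?A = "{var (0, 0), var (1, 0) - 1, var (0, 1) - 1} :: (nat \<times> nat, 'a) mpoly set"
  let ?B = "{var (0, i) | i. 2 \<le> i \<and> i \<le> q - 2} \<union> {var (i, 0) | i. 2 \<le> i \<and> i \<le> q - 2}
    :: (nat \<times> nat, 'a) mpoly set"
  have q3: "q \<ge> 3"
    using q(2) by simp
  note A = MP.genideal_ideal[OF reduced_gens_carrier(1)[OF q3]]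
    and B = MP.genideal_ideal[OF reduced_gens_carrier(2)[OF q3]]
  have "add_reduced q I \<subseteq> vanish s \<longleftrightarrow>
      I \<subseteq> vanish s \<and> (\<forall>p\<in>?A. eval_at s p = 0) \<and> (\<forall>p\<in>?B. eval_at s p = 0)"
    unfolding add_reduced_def vanish_def
    by (simp only: set_add_subset_ideal_iff[OF MP.add_ideals[OF assms A] B ideal_vanishing]
        set_add_subset_ideal_iff[OF assms A ideal_vanishing] conj_assoc
        Idl_subset_vanishing[OF reduced_gens_carrier(1)[OF q3]]
        Idl_subset_vanishing[OF reduced_gens_carrier(2)[OF q3]])
  also have "(\<forall>p\<in>?A. eval_at s p = 0) \<longleftrightarrow> s (0, 0) = 0 \<and> s (1, 0) = 1 \<and> s (0, 1) = 1"
    by (simp add: eval_at_eq_ev eval.ev_diff)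
  also have "(\<forall>p\<in>?B. eval_at s p = 0) \<longleftrightarrow>
      (\<forall>i. 2 \<le> i \<and> i \<le> q - 2 \<longrightarrow> s (0, i) = 0 \<and> s (i, 0) = 0)"
    by (auto simp: eval_at_eq_ev setcompr_eq_image ball_Un)
  finally show ?thesis
    by (simp add: reduced_poly_of_point[OF q3])
qed

lemma algebraic_set_bij_betw:
  assumes "ideal I (polring q)" "R \<subseteq> LP q"
    and "\<And>s. I \<subseteq> vanish s \<longleftrightarrow> poly_of_point q s \<in> R"
  shows "bij_betw (poly_of_point q) (algebraic_set (idx q) I) R"
proof -
  have "algebraic_set (idx q) I = {s \<in> idx q \<rightarrow>\<^sub>E UNIV. poly_of_point q s \<in> R}"
    using algebraic_set_ideal[OF assms(1)] assms(3) by (simp add: vanish_def)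
  moreover have "Poly_Mapping.keys f \<subseteq> mxy ` idx q" if "f \<in> R" for f
    using LP_keys_subset[of f] that assms(2) q by auto
  ultimately show ?thesis
    using bij_betw_poly_of_point[of R q] by simp
qed

end

theorem proposition3p4:
  fixes q :: nat
  assumes "primepow q" and "q > 3" and "card (UNIV :: 'a::{finite,field} set) = q"
  shows
    "(let I = add_reduced q (J q :: (nat \<times> nat, 'a) mpoly set) in
        zero_dimensional (idx q) I \<and>
        radical_ideal I (polring q) \<and>
        bij_betw (poly_of_point q) (algebraic_set (idx q) I) (RLP q)) \<and>
     (\<forall>d. let I = add_reduced q (J_deg q d :: (nat \<times> nat, 'a) mpoly set) in
        zero_dimensional (idx q) I \<and>
        radical_ideal I (polring q) \<and>
        bij_betw (poly_of_point q) (algebraic_set (idx q) I) (RLP_deg q d))"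
proof -
  have q: "q = CARD('a)" "q > 3" and q3: "q \<ge> 3"
    using assms by simp_all
  \<comment> \<open>Stated for every ideal above \<open>J q\<close>, so that one argument serves
    \<open>J q\<close> and all \<open>J_deg q d\<close>.\<close>
  have zero_dim_radical: "zero_dimensional (idx q) (add_reduced q I) \<and> radical_ideal (add_reduced q I) (polring q)"
    if I: "ideal I (polring q)" and "J q \<subseteq> I" for I :: "(nat \<times> nat, 'a) mpoly set"
  proof -
    have "var v ^ q - var v \<in> add_reduced q I" if "v \<in> idx q" for v
      using field_equation_in_J[OF that] \<open>J q \<subseteq> I\<close> subset_add_reduced[OF q3 I] by blast
    then show ?thesis
      using zero_dimensional_if_field_equations[OF ideal_add_reduced[OF q3 I] finite_idx q(1) assms(1)]
        radical_ideal_if_field_equations[OF ideal_add_reduced[OF q3 I] finite_idx q(1) assms(1)]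
      by blast
  qed
  have "bij_betw (poly_of_point q) (algebraic_set (idx q) (add_reduced q (J q :: (nat \<times> nat, 'a) mpoly set))) (RLP q)"
    by (rule algebraic_set_bij_betw[OF q ideal_add_reduced[OF q3 ideal_J]])
      (auto simp: RLP_def add_reduced_vanishes_iff[OF q ideal_J] J_vanishes_iff[OF q])
  moreover have "bij_betw (poly_of_point q)
      (algebraic_set (idx q) (add_reduced q (J_deg q d :: (nat \<times> nat, 'a) mpoly set))) (RLP_deg q d)" for d
  proof (rule algebraic_set_bij_betw[OF q ideal_add_reduced[OF q3 ideal_J_deg]])
    fix s :: "nat \<times> nat \<Rightarrow> 'a"
    have "total_deg (poly_of_point q s) = d \<longleftrightarrow>
        (\<forall>i j. (i, j) \<in> idx q \<and> i + j > d \<longrightarrow> s (i, j) = 0) \<and>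
        (\<exists>i j. (i, j) \<in> idx q \<and> i + j = d \<and> s (i, j) \<noteq> 0)" if "reduced (poly_of_point q s)"
      \<comment> \<open>The witness is the monomial x, whose coefficient is 1 in a reduced
        polynomial.\<close>
      using that q3 by (intro total_deg_poly_of_point[of 1 0]) (auto simp: reduced_poly_of_point idx_def)
    then show "add_reduced q (J_deg q d) \<subseteq> {p \<in> carrier (polring q). eval_at s p = 0} \<longleftrightarrow>
        poly_of_point q s \<in> RLP_deg q d"
      unfolding add_reduced_vanishes_iff[OF q ideal_J_deg] J_deg_vanishes_iff[OF q] RLP_deg_def RLP_def
      by blast
  qed (auto simp: RLP_deg_def RLP_def)
  ultimately show ?thesis
    using zero_dim_radical[OF ideal_J order_refl] zero_dim_radical[OF ideal_J_deg J_subset_J_deg]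
    by (simp add: Let_def)
qed

end
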